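(* Deep OptEqs contain all feedforward DNNs. Precisely: let $\sigma:\mathbb{R}\to\mathbb{R}$ be a function (applied element-wise to vectors), and let a feedforward network $\mathbf x\mapsto\mathbf y$ on $\mathbb{R}^{d_x}$ be given by $$\mathbf h_1=\sigma(\mathbf A_1\mathbf x+\mathbf c_1),\qquad \mathbf h_{k}=\sigma(\mathbf A_{k}\mathbf h_{k-1}+\mathbf c_{k})\ (2\le k\le r-1),\qquad \mathbf y=\mathbf A_r\mathbf h_{r-1},$$ with $r\ge2$ and real matrices $\mathbf A_k$ and vectors $\mathbf c_k$ of compatible sizes. Then there is a deep OptEq with activation $\sigma$ such that, for every input $\mathbf x_0\in\mathbb{R}^{d_x}$, its equilibrium equation has a solution, and at every solution its output equals the output of the feedforward network on the input $\mathbf x_0$.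
   Context: A deep OptEq with activation $\sigma$ is specified by an integer $L\ge1$, a hidden dimension $m$, a parameter $\alpha\in(0,1]$, a continuous map $g:\mathbb{R}^{d_x}\to\mathbb{R}^d$ (the feature extractor, for instance the identity), matrices $\mathbf W_l\in\mathbb{R}^{n_l\times m}$, $\mathbf U_l\in\mathbb{R}^{n_l\times d}$, vectors $\mathbf b_l\in\mathbb{R}^{n_l}$ ($1\le l\le L$), and an output matrix $\mathbf W_{L+1}\in\mathbb{R}^{d_y\times m}$. For the input $\mathbf x_0$ it sets $\mathbf x=g(\mathbf x_0)$, and the hidden unit $\mathbf z\in\mathbb{R}^m$ is a solution of the equilibrium equation $\mathbf z=f_L\circ\cdots\circ f_1(\mathbf z)$, where $f_l(\mathbf z)=\alpha\mathbf W_l^\top\sigma(\mathbf W_l\mathbf z+\mathbf U_l\mathbf x+\mathbf b_l)+(1-\alpha)\mathbf z$. The output is $\mathbf y=\mathbf W_{L+1}\mathbf z$. *)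

theory Defs
  imports
    "HOL-Analysis.Abstract_Euclidean_Space"
    "Jordan_Normal_Form.Matrix"
begin

text \<open>
  Real vectors and matrices of size given by natural numbers are taken from
  Jordan_Normal_Form. That theory puts no topology on vectors; the one on
  \<^term>\<open>carrier_vec n\<close> is transported from \<^const>\<open>Euclidean_space\<close> along the zero-padding
  map.
\<close>

definition vec_fun :: "real vec \<Rightarrow> nat \<Rightarrow> real" where
  "vec_fun v = (\<lambda>i. if i < dim_vec v then v $ i else 0)"

definition vec_topology :: "nat \<Rightarrow> real vec topology" where
  "vec_topology n = pullback_topology (carrier_vec n) vec_fun (Euclidean_space n)"

lemma topspace_vec_topology [simp]: "topspace (vec_topology n) = carrier_vec n"
  by (auto simp: vec_topology_def topspace_pullback_topology topspace_Euclidean_space vec_fun_def)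

lemma homeomorphic_maps_vec_topology:
  "homeomorphic_maps (vec_topology n) (Euclidean_space n) vec_fun (vec n)"
proof -
  have 1: "continuous_map (vec_topology n) (Euclidean_space n) vec_fun"
    unfolding vec_topology_def
    using continuous_map_pullback[of "Euclidean_space n" "Euclidean_space n" id "carrier_vec n" vec_fun]
    by simp
  have inv: "vec_fun (vec n y) = y" if "y \<in> topspace (Euclidean_space n)" for y
    using that by (auto simp: topspace_Euclidean_space vec_fun_def)
  have "continuous_map (Euclidean_space n) (Euclidean_space n) (vec_fun \<circ> vec n)"
    using continuous_map_id by (rule continuous_map_eq) (simp add: inv)
  then have 2: "continuous_map (Euclidean_space n) (vec_topology n) (vec n)"
    unfolding vec_topology_def by (rule continuous_map_pullback') auto
  have "vec n (vec_fun v) = v" if "v \<in> carrier_vec n" for v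
    using that by (auto simp: vec_fun_def)
  with 1 2 inv show ?thesis
    by (simp add: homeomorphic_maps_def)
qed


text \<open>
  Layers are indexed from 1, as in the index sets of the well-formedness predicates; the values of
  the indexed families outside these ranges are irrelevant. All dimensions are positive.
\<close>

record deep_opteq =
  oe_depth :: nat
  oe_hidden_dim :: nat
  oe_feature_dim :: nat
  oe_layer_dim :: "nat \<Rightarrow> nat"
  oe_alpha :: real
  oe_feature :: "real vec \<Rightarrow> real vec"
  oe_W :: "nat \<Rightarrow> real mat"
  oe_U :: "nat \<Rightarrow> real mat"
  oe_b :: "nat \<Rightarrow> real vec"

definition is_deep_opteq :: "nat \<Rightarrow> nat \<Rightarrow> deep_opteq \<Rightarrow> bool" where
  "is_deep_opteq dx dy E \<longleftrightarrow>
     0 < dx \<and> 0 < dy \<and> 1 \<le> oe_depth E \<and> 0 < oe_hidden_dim E \<and> 0 < oe_feature_dim E \<and>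
     0 < oe_alpha E \<and> oe_alpha E \<le> 1 \<and>
     continuous_map (vec_topology dx) (vec_topology (oe_feature_dim E)) (oe_feature E) \<and>
     (\<forall>l\<in>{1..oe_depth E}.
        0 < oe_layer_dim E l \<and>
        oe_W E l \<in> carrier_mat (oe_layer_dim E l) (oe_hidden_dim E) \<and>
        oe_U E l \<in> carrier_mat (oe_layer_dim E l) (oe_feature_dim E) \<and>
        oe_b E l \<in> carrier_vec (oe_layer_dim E l)) \<and>
     oe_W E (oe_depth E + 1) \<in> carrier_mat dy (oe_hidden_dim E)"

definition oe_layer ::
  "(real \<Rightarrow> real) \<Rightarrow> deep_opteq \<Rightarrow> real vec \<Rightarrow> nat \<Rightarrow> real vec \<Rightarrow> real vec" where
  "oe_layer \<sigma> E x l z =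
     oe_alpha E \<cdot>\<^sub>v (transpose_mat (oe_W E l) *\<^sub>v
        map_vec \<sigma> (oe_W E l *\<^sub>v z + oe_U E l *\<^sub>v x + oe_b E l))
     + (1 - oe_alpha E) \<cdot>\<^sub>v z"

primrec oe_compose ::
  "(real \<Rightarrow> real) \<Rightarrow> deep_opteq \<Rightarrow> real vec \<Rightarrow> nat \<Rightarrow> real vec \<Rightarrow> real vec" where
  "oe_compose \<sigma> E x 0 = id"
| "oe_compose \<sigma> E x (Suc l) = oe_layer \<sigma> E x (Suc l) \<circ> oe_compose \<sigma> E x l"

definition oe_equilibrium ::
  "(real \<Rightarrow> real) \<Rightarrow> deep_opteq \<Rightarrow> real vec \<Rightarrow> real vec \<Rightarrow> bool" where
  "oe_equilibrium \<sigma> E x0 z \<longleftrightarrow>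
     z \<in> carrier_vec (oe_hidden_dim E) \<and>
     z = oe_compose \<sigma> E (oe_feature E x0) (oe_depth E) z"

definition oe_output :: "deep_opteq \<Rightarrow> real vec \<Rightarrow> real vec" where
  "oe_output E z = oe_W E (oe_depth E + 1) *\<^sub>v z"


text \<open>
  A feedforward network whose \<open>k\<close>-th layer has width \<^term>\<open>ff_width N k\<close>; the input is layer 0,
  the output is layer \<^term>\<open>ff_depth N\<close>, which has neither bias nor activation.
\<close>

record feedforward =
  ff_depth :: nat
  ff_width :: "nat \<Rightarrow> nat"
  ff_A :: "nat \<Rightarrow> real mat"
  ff_c :: "nat \<Rightarrow> real vec"

definition is_feedforward :: "nat \<Rightarrow> nat \<Rightarrow> feedforward \<Rightarrow> bool" where
  "is_feedforward dx dy N \<longleftrightarrow>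
     2 \<le> ff_depth N \<and> ff_width N 0 = dx \<and> ff_width N (ff_depth N) = dy \<and>
     (\<forall>k\<in>{0..ff_depth N}. 0 < ff_width N k) \<and>
     (\<forall>k\<in>{1..ff_depth N}. ff_A N k \<in> carrier_mat (ff_width N k) (ff_width N (k - 1))) \<and>
     (\<forall>k\<in>{1..ff_depth N - 1}. ff_c N k \<in> carrier_vec (ff_width N k))"

primrec ff_hidden :: "(real \<Rightarrow> real) \<Rightarrow> feedforward \<Rightarrow> real vec \<Rightarrow> nat \<Rightarrow> real vec" where
  "ff_hidden \<sigma> N x 0 = x"
| "ff_hidden \<sigma> N x (Suc k) =
     map_vec \<sigma> (ff_A N (Suc k) *\<^sub>v ff_hidden \<sigma> N x k + ff_c N (Suc k))"

definition ff_output :: "(real \<Rightarrow> real) \<Rightarrow> feedforward \<Rightarrow> real vec \<Rightarrow> real vec" where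
  "ff_output \<sigma> N x = ff_A N (ff_depth N) *\<^sub>v ff_hidden \<sigma> N x (ff_depth N - 1)"

end

theory Submission
  imports Defs
begin

text \<open>
  With \<open>\<alpha> = 1\<close>, consecutive layers of a deep OptEq interact only through the products
  \<open>W\<^sub>l W\<^sub>l\<^sub>-\<^sub>1\<^sup>T\<close>, and these can be prescribed: reserve a block of hidden coordinates for every
  layer of the network, and let \<open>W\<^sub>l\<close> carry the identity in block \<open>l\<close> and \<open>A\<^sub>l\<close> in block
  \<open>l - 1\<close>, so that \<open>W\<^sub>l W\<^sub>l\<^sub>-\<^sub>1\<^sup>T = A\<^sub>l\<close>. An extra first layer with all weights zero maps every state
  to 0. The composition is therefore constant, and its value is the only equilibrium.
\<close>

text \<open>Block 0 belongs to the input and block \<open>ff_depth N\<close> to the output, so the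
  value at \<open>ff_depth N + 1\<close> is the total hidden dimension.\<close>

definition block_start :: "feedforward \<Rightarrow> nat \<Rightarrow> nat" where
  "block_start N k = (\<Sum>j<k. ff_width N j)"

text \<open>At \<open>k = 0\<close> truncated subtraction makes the range of the second case empty,
  so only the identity block remains.\<close>

definition block_weight :: "feedforward \<Rightarrow> nat \<Rightarrow> real mat" where
  "block_weight N k = mat (ff_width N k) (block_start N (ff_depth N + 1))
     (\<lambda>(i, j). if j = block_start N k + i then 1
        else if block_start N (k - 1) \<le> j \<and> j < block_start N k
          then ff_A N k $$ (i, j - block_start N (k - 1)) else 0)"

text \<open>Indices shift by one: after the erasing layer 1, layer \<open>l\<close> simulates
  network layer \<open>l - 1\<close>. The input enters through \<open>oe_U\<close> at layer 2, and
  the output matrix, at index \<open>ff_depth N + 1\<close>, is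
  \<open>block_weight N (ff_depth N)\<close>.\<close>

definition opteq_of_feedforward :: "nat \<Rightarrow> feedforward \<Rightarrow> deep_opteq" where
  "opteq_of_feedforward dx N = \<lparr>
     oe_depth = ff_depth N,
     oe_hidden_dim = block_start N (ff_depth N + 1),
     oe_feature_dim = dx,
     oe_layer_dim = (\<lambda>l. ff_width N (l - 1)),
     oe_alpha = 1,
     oe_feature = id,
     oe_W = (\<lambda>l. if l = 1 then 0\<^sub>m (ff_width N 0) (block_start N (ff_depth N + 1))
                 else block_weight N (l - 1)),
     oe_U = (\<lambda>l. if l = 2 then ff_A N 1 else 0\<^sub>m (ff_width N (l - 1)) dx),
     oe_b = (\<lambda>l. if l = 1 then 0\<^sub>v (ff_width N 0) else ff_c N (l - 1))\<rparr>"

lemma block_start_Suc: "block_start N (Suc k) = block_start N k + ff_width N k"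
  by (simp add: block_start_def)

lemma block_start_mono: "k \<le> l \<Longrightarrow> block_start N k \<le> block_start N l"
  by (auto simp: block_start_def intro!: sum_mono2)

lemma block_weight_carrier [simp]:
  "block_weight N k \<in> carrier_mat (ff_width N k) (block_start N (ff_depth N + 1))"
  by (simp add: block_weight_def)

lemma dim_block_weight [simp]:
  "dim_row (block_weight N k) = ff_width N k"
  "dim_col (block_weight N k) = block_start N (ff_depth N + 1)"
  by (simp_all add: block_weight_def)

lemma ff_A_carrier:
  assumes "is_feedforward dx dy N" "k < ff_depth N"
  shows "ff_A N (Suc k) \<in> carrier_mat (ff_width N (Suc k)) (ff_width N k)"
proof -
  have "Suc k \<in> {1..ff_depth N}"
    using assms(2) by simp
  with assms(1) show ?thesis
    unfolding is_feedforward_def by (metis diff_Suc_1)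
qed

lemma ff_c_carrier:
  assumes "is_feedforward dx dy N" "0 < k" "k < ff_depth N"
  shows "ff_c N k \<in> carrier_vec (ff_width N k)"
  using assms by (simp add: is_feedforward_def)

text \<open>The nonzero columns of the two weights lie in blocks \<open>k\<close>,
  \<open>Suc k\<close> and in blocks \<open>k - 1\<close>, \<open>k\<close>. Only block
  \<open>k\<close> is shared; there one factor holds \<open>ff_A N (Suc k)\<close> and the other the
  identity. The case \<open>Suc k = ff_depth N\<close> serves the output matrix.\<close>

lemma block_weight_mult_transpose:
  assumes N: "is_feedforward dx dy N" and k: "k < ff_depth N"
  shows "block_weight N (Suc k) * transpose_mat (block_weight N k) = ff_A N (Suc k)"
    (is "?L = ?R")
proof (rule eq_matI)
  have A: "ff_A N (Suc k) \<in> carrier_mat (ff_width N (Suc k)) (ff_width N k)"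
    by (rule ff_A_carrier[OF N k])
  fix i i' assume "i < dim_row ?R" "i' < dim_col ?R"
  with A have i: "i < ff_width N (Suc k)" and i': "i' < ff_width N k" by auto
  let ?m = "block_start N (ff_depth N + 1)"
  have start: "block_start N (k - 1) \<le> block_start N k"
    by (rule block_start_mono) simp
  have "block_start N (Suc k) \<le> ?m"
    using k by (intro block_start_mono) simp
  with i' have col: "block_start N k + i' < ?m"
    by (simp add: block_start_Suc)
  have "?L $$ (i, i') =
      (\<Sum>j = 0..<?m. block_weight N (Suc k) $$ (i, j) * block_weight N k $$ (i', j))"
    using i i' by (simp add: block_weight_def scalar_prod_def)
  \<comment> \<open>Row \<open>i'\<close> of the identity has its single 1 in this column, which
    selects column \<open>i'\<close> of \<open>?R\<close>.\<close>
  also have "\<dots> = (\<Sum>j = 0..<?m. if j = block_start N k + i' then ?R $$ (i, i') else 0)"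
    using i i' start by (intro sum.cong) (auto simp: block_weight_def block_start_Suc)
  also have "\<dots> = ?R $$ (i, i')"
    using col by simp
  finally show "?L $$ (i, i') = ?R $$ (i, i')" .
qed (use ff_A_carrier[OF N k] in \<open>auto simp: block_weight_def\<close>)

lemma is_deep_opteq_of_feedforward:
  assumes N: "is_feedforward dx dy N"
  shows "is_deep_opteq dx dy (opteq_of_feedforward dx N)"
proof -
  have pos: "0 < dx" "0 < dy"
    using N by (auto simp: is_feedforward_def)
  moreover have "0 < block_start N (Suc (ff_depth N))"
    using N pos by (simp add: is_feedforward_def block_start_Suc)
  moreover have "0 < ff_width N (l - 1)" if "l \<in> {1..ff_depth N}" for l
    using N that by (auto simp: is_feedforward_def)
  moreover have "ff_c N (l - 1) \<in> carrier_vec (ff_width N (l - 1))"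
    if "l \<in> {1..ff_depth N}" "l \<noteq> 1" for l
    using that by (intro ff_c_carrier[OF N]) auto
  moreover have "ff_A N 1 \<in> carrier_mat (ff_width N 1) dx"
    using ff_A_carrier[OF N, of 0] N by (simp add: is_feedforward_def)
  moreover have "2 \<le> ff_depth N" "ff_width N (ff_depth N) = dy"
    using N by (auto simp: is_feedforward_def)
  ultimately show ?thesis
    using block_weight_carrier[of N]
    by (auto simp: is_deep_opteq_def opteq_of_feedforward_def numeral_2_eq_2)
qed

lemma ff_hidden_carrier:
  assumes "is_feedforward dx dy N" "x \<in> carrier_vec dx" "k < ff_depth N"
  shows "ff_hidden \<sigma> N x k \<in> carrier_vec (ff_width N k)"
proof (cases k)
  case 0
  with assms show ?thesis
    by (simp add: is_feedforward_def)
next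
  case (Suc j)
  with assms ff_A_carrier[of dx dy N j] ff_c_carrier[of dx dy N k] show ?thesis
    by (intro carrier_vecI) simp
qed

lemma oe_layer_opteq_of_feedforward:
  assumes "z \<in> carrier_vec (block_start N (ff_depth N + 1))" "0 < k"
  shows "oe_layer \<sigma> (opteq_of_feedforward dx N) x (Suc k) z =
    transpose_mat (block_weight N k) *\<^sub>v map_vec \<sigma> (block_weight N k *\<^sub>v z +
      (if k = 1 then ff_A N 1 else 0\<^sub>m (ff_width N k) dx) *\<^sub>v x + ff_c N k)"
    (is "_ = ?v")
proof -
  have "?v \<in> carrier_vec (block_start N (ff_depth N + 1))"
    by (intro carrier_vecI) simp
  \<comment> \<open>The skip term at \<alpha> = 1. A vector sum takes its dimension from the right
    summand, so the dimension of \<open>z\<close> matters although its entries are multiplied by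
    0.\<close>
  with assms(1) have "?v + 0 \<cdot>\<^sub>v z = ?v"
    by (intro eq_vecI) (simp_all del: index_mult_mat_vec)
  with assms(2) show ?thesis
    by (cases "k = 1") (simp_all add: oe_layer_def opteq_of_feedforward_def)
qed

text \<open>The value \<open>\<sigma> 0\<close> may be nonzero, but the transposed zero weight
  outside the activation annihilates it.\<close>

lemma oe_compose_opteq_of_feedforward_1:
  assumes "z \<in> carrier_vec (block_start N (ff_depth N + 1))"
  shows "oe_compose \<sigma> (opteq_of_feedforward dx N) x (Suc 0) z =
    0\<^sub>v (block_start N (ff_depth N + 1))"
  using assms by (auto simp: oe_layer_def opteq_of_feedforward_def scalar_prod_def)

text \<open>Each further layer applies its weight to the transposed previous one, and
  \<open>block_weight_mult_transpose\<close> turns this product into the network matrix. The value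
  is free of \<open>z\<close> because layer 1 has erased it.\<close>

lemma oe_compose_opteq_of_feedforward:
  assumes N: "is_feedforward dx dy N" and x: "x \<in> carrier_vec dx"
    and z: "z \<in> carrier_vec (block_start N (ff_depth N + 1))"
    and "Suc k < ff_depth N"
  shows "oe_compose \<sigma> (opteq_of_feedforward dx N) x (Suc (Suc k)) z =
    transpose_mat (block_weight N (Suc k)) *\<^sub>v ff_hidden \<sigma> N x (Suc k)"
  using \<open>Suc k < ff_depth N\<close>
proof (induction k)
  case 0
  let ?m = "block_start N (ff_depth N + 1)"
  have A: "ff_A N 1 \<in> carrier_mat (ff_width N 1) dx"
    using ff_A_carrier[OF N, of 0] N 0 by (simp add: is_feedforward_def)
  \<comment> \<open>The state after layer 1 is zero, so the preactivation is that of the first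
    network layer.\<close>
  have "block_weight N 1 *\<^sub>v 0\<^sub>v ?m = 0\<^sub>v (ff_width N 1)"
    by (auto simp: block_weight_def scalar_prod_def)
  moreover have "0\<^sub>v (ff_width N 1) + ff_A N 1 *\<^sub>v x = ff_A N 1 *\<^sub>v x"
    using A by (intro left_zero_vec carrier_vecI) simp
  ultimately show ?case
    unfolding oe_compose.simps(2)[of _ _ _ "Suc 0"] comp_def
      oe_compose_opteq_of_feedforward_1[OF z]
    by (simp add: oe_layer_opteq_of_feedforward)
next
  case (Suc k)
  let ?W = "block_weight N" and ?h = "ff_hidden \<sigma> N x"
  have h: "?h (Suc k) \<in> carrier_vec (ff_width N (Suc k))"
    using Suc.prems by (intro ff_hidden_carrier[OF N x]) simp
  have "?W (Suc (Suc k)) *\<^sub>v (transpose_mat (?W (Suc k)) *\<^sub>v ?h (Suc k)) =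
      (?W (Suc (Suc k)) * transpose_mat (?W (Suc k))) *\<^sub>v ?h (Suc k)"
    using h by (intro assoc_mult_mat_vec[symmetric]) auto
  also have "\<dots> = ff_A N (Suc (Suc k)) *\<^sub>v ?h (Suc k)"
    using Suc.prems by (simp add: block_weight_mult_transpose[OF N])
  finally have W: "?W (Suc (Suc k)) *\<^sub>v (transpose_mat (?W (Suc k)) *\<^sub>v ?h (Suc k)) =
      ff_A N (Suc (Suc k)) *\<^sub>v ?h (Suc k)" .
  have A: "ff_A N (Suc (Suc k)) \<in> carrier_mat (ff_width N (Suc (Suc k))) (ff_width N (Suc k))"
    using Suc.prems by (intro ff_A_carrier[OF N]) simp
  have IH: "oe_compose \<sigma> (opteq_of_feedforward dx N) x (Suc (Suc k)) z =
      transpose_mat (?W (Suc k)) *\<^sub>v ?h (Suc k)"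
    using Suc by simp
  \<comment> \<open>Beyond layer 2 the input reaches the state only through the previous
    state.\<close>
  have zero: "0\<^sub>m (ff_width N (Suc (Suc k))) dx *\<^sub>v x = 0\<^sub>v (ff_width N (Suc (Suc k)))"
    using x by (auto simp: scalar_prod_def)
  have state: "transpose_mat (?W (Suc k)) *\<^sub>v ?h (Suc k)
      \<in> carrier_vec (block_start N (ff_depth N + 1))"
    by (intro carrier_vecI) simp
  have "ff_A N (Suc (Suc k)) *\<^sub>v ?h (Suc k) + 0\<^sub>v (ff_width N (Suc (Suc k))) =
      ff_A N (Suc (Suc k)) *\<^sub>v ?h (Suc k)"
    using A by (intro right_zero_vec carrier_vecI) simp
  then show ?case
    unfolding oe_compose.simps(2)[of _ _ _ "Suc (Suc k)"] comp_def IH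
      ff_hidden.simps(2)[of _ _ _ "Suc k"]
      oe_layer_opteq_of_feedforward[OF state zero_less_Suc] W
    by (simp add: zero del: ff_hidden.simps)
qed

theorem lemma2:
  fixes \<sigma> :: "real \<Rightarrow> real" and dx dy :: nat and N :: feedforward
  assumes "is_feedforward dx dy N"
  shows "\<exists>E :: deep_opteq. is_deep_opteq dx dy E \<and>
           (\<forall>x0 \<in> carrier_vec dx.
              (\<exists>z. oe_equilibrium \<sigma> E x0 z) \<and>
              (\<forall>z. oe_equilibrium \<sigma> E x0 z \<longrightarrow> oe_output E z = ff_output \<sigma> N x0))"
proof (rule exI[of _ "opteq_of_feedforward dx N"], intro conjI ballI)
  let ?E = "opteq_of_feedforward dx N" and ?W = "block_weight N"
  show "is_deep_opteq dx dy ?E"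
    using assms by (rule is_deep_opteq_of_feedforward)
  fix x :: "real vec" assume x: "x \<in> carrier_vec dx"
  have "2 \<le> ff_depth N"
    using assms by (simp add: is_feedforward_def)
  \<comment> \<open>\<open>Suc k\<close> is the last hidden layer of the network, simulated by the
    last layer of the OptEq.\<close>
  then obtain k where k: "ff_depth N = Suc (Suc k)"
    by (metis add_2_eq_Suc le_Suc_ex)
  let ?h = "ff_hidden \<sigma> N x (Suc k)"
  let ?z = "transpose_mat (?W (Suc k)) *\<^sub>v ?h"
  have h: "?h \<in> carrier_vec (ff_width N (Suc k))"
    using k by (intro ff_hidden_carrier[OF assms x]) simp
  \<comment> \<open>The composition is constant on the hidden space, so its value is a fixed point
    and the only one.\<close>
  have equilibrium: "oe_equilibrium \<sigma> ?E x z \<longleftrightarrow> z = ?z" for z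
  proof -
    have "?z \<in> carrier_vec (oe_hidden_dim ?E)"
      by (intro carrier_vecI) (simp add: opteq_of_feedforward_def)
    moreover have "oe_compose \<sigma> ?E (oe_feature ?E x) (oe_depth ?E) z = ?z"
      if "z \<in> carrier_vec (oe_hidden_dim ?E)" for z
    proof -
      have "oe_feature ?E x = x" "oe_depth ?E = Suc (Suc k)"
        by (simp_all add: opteq_of_feedforward_def k)
      then show ?thesis
        using oe_compose_opteq_of_feedforward[OF assms x, of z k] that k
        by (simp only: opteq_of_feedforward_def deep_opteq.simps)
    qed
    ultimately show ?thesis
      unfolding oe_equilibrium_def by metis
  qed
  then show "\<exists>z. oe_equilibrium \<sigma> ?E x z"
    by blast
  \<comment> \<open>The output matrix meets the transposed last weight, which leaves the final
    network matrix.\<close>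
  have "?W (Suc (Suc k)) *\<^sub>v ?z = (?W (Suc (Suc k)) * transpose_mat (?W (Suc k))) *\<^sub>v ?h"
    using h by (intro assoc_mult_mat_vec[symmetric]) auto
  also have "\<dots> = ff_output \<sigma> N x"
    using k by (simp add: block_weight_mult_transpose[OF assms] ff_output_def del: ff_hidden.simps)
  finally have "oe_output ?E ?z = ff_output \<sigma> N x"
    by (simp add: oe_output_def opteq_of_feedforward_def k del: ff_hidden.simps)
  with equilibrium show "\<forall>z. oe_equilibrium \<sigma> ?E x z \<longrightarrow> oe_output ?E z = ff_output \<sigma> N x"
    by metis
qed

end
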